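(* For every positive integer $n$, the set $S_{2n}=\{y\in[0,2/3] : \operatorname{card} L(y)=2n\}$ has positive Lebesgue measure, i.e. $\mathcal{L}(S_{2n})>0$.
   Context: Let $\phi(x):=\operatorname{dist}(x,\mathbb{Z})$ be the distance from $x\in\mathbb{R}$ to the nearest integer. The (classical) Takagi function $T$ is defined by $T(x):=\sum_{i=0}^{\infty}\phi(2^i x)/2^i$ for $x\in[0,1]$. For $y\in\mathbb{R}$, the level set of $T$ at height $y$ is $L(y):=\{x\in[0,1] : T(x)=y\}$. For each positive integer $m$, $S_m:=\{y\in[0,2/3] : \operatorname{card} L(y)=m\}$, where $\operatorname{card}$ denotes the number of elements. $\mathcal{L}$ denotes one-dimensional Lebesgue measure. *)

theory Defs
  imports "HOL-Analysis.Analysis"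
begin

definition dist_int :: "real \<Rightarrow> real" where
  "dist_int x = infdist x \<int>"

text \<open>The series converges for every real argument; the restriction to the unit
  interval is imposed in the level sets.\<close>

definition takagi :: "real \<Rightarrow> real" where
  "takagi x = (\<Sum>i. dist_int (2 ^ i * x) / 2 ^ i)"

lemma summable_takagi: "summable (\<lambda>i. dist_int (2 ^ i * x) / 2 ^ i)"
proof (rule summable_comparison_test')
  show "summable (\<lambda>i. (1 / 2 :: real) ^ i)"
    by (rule summable_geometric) simp
  have bound: "dist_int y \<le> 1" for y
  proof -
    have "dist_int y \<le> dist y (of_int \<lfloor>y\<rfloor>)"
      unfolding dist_int_def by (rule infdist_le) simp
    also have "\<dots> \<le> 1"
      unfolding dist_real_def by linarith
    finally show ?thesis .
  qed
  show "norm (dist_int (2 ^ i * x) / 2 ^ i) \<le> (1 / 2) ^ i" if "0 \<le> i" for i :: nat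
    using bound[of "2 ^ i * x"] infdist_nonneg[of "2 ^ i * x" \<int>]
    by (simp add: dist_int_def power_one_over divide_right_mono inverse_eq_divide)
qed

definition takagi_level :: "real \<Rightarrow> real set" where
  "takagi_level y = {x \<in> {0..1}. takagi x = y}"

text \<open>Since \<open>card\<close> is 0 on infinite sets, finiteness is stated explicitly.\<close>

definition takagi_heights :: "nat \<Rightarrow> real set" where
  "takagi_heights m = {y \<in> {0..2/3}. finite (takagi_level y) \<and> card (takagi_level y) = m}"

end

theory Submission
  imports Defs
begin

text \<open>Let \<open>T_k(x) = T(x) - k x\<close> on the unit interval. Halving the interval expresses the solutions of
  \<open>T_k(x) = v\<close> through those of \<open>T_{k-1} = 2v\<close> (left half) and \<open>T_{k+1} = 2v + k - 1\<close> (right half).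
  The tile \<open>[-k, 0]\<close> is split exactly by these two maps into the tiles of \<open>k - 1\<close> and \<open>k + 1\<close>, so every
  height in a tile has a solution whose walk of slopes never reaches 0, and this solution is unique;
  the other solutions come from walks that reach 0, and they live over small affine copies (humps) of
  the range \<open>[0, 2/3]\<close> of \<open>T\<close>. The humps over the tile of \<open>k\<close> have total length at most 2/3, namely
  2/3 times the probability that a fair walk from \<open>k\<close> reaches 0.

  Let \<open>P(m)\<close> say that the heights \<open>y > 1/6\<close> with \<open>2m\<close> preimages are not negligible. \<open>P(1)\<close> holds as
  most of a tile is free of humps. \<open>P(r)\<close> gives \<open>P(2r)\<close> because \<open>1/2 + z/4\<close> has twice as many preimages
  as \<open>z > 1/6\<close>. Finally \<open>P(r)\<close> gives \<open>P(2r + 1)\<close>: in a tile of large slope \<open>j\<close> look at one particular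
  hump; the total length of the further humps meeting it tends to 0 as \<open>j\<close> grows, so a non-negligible
  set of heights has one tile solution and \<open>2r\<close> hump solutions.\<close>

section \<open>The Takagi function\<close>

lemma dist_int_le: "dist_int x \<le> \<bar>x - of_int m\<bar>"
  unfolding dist_int_def dist_real_def[symmetric] by (rule infdist_le) simp

lemma dist_int_greatest: "(\<And>m. a \<le> \<bar>x - of_int m\<bar>) \<Longrightarrow> a \<le> dist_int x"
  unfolding dist_int_def infdist_def
  by (auto simp: dist_real_def Ints_def intro!: cINF_greatest)

lemma dist_int_nonneg: "0 \<le> dist_int x"
  by (simp add: dist_int_def infdist_nonneg)

lemma dist_int_add1: "dist_int (x + 1) = dist_int x"
proof (rule antisym; rule dist_int_greatest)
  fix m
  show "dist_int (x + 1) \<le> \<bar>x - of_int m\<bar>"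
    using dist_int_le[of "x + 1" "m + 1"] by simp
  show "dist_int x \<le> \<bar>x + 1 - of_int m\<bar>"
    using dist_int_le[of x "m - 1"] by (simp add: algebra_simps)
qed

lemma dist_int_minus: "dist_int (- x) = dist_int x"
proof -
  have "dist_int (- x) \<le> dist_int x" for x
  proof (rule dist_int_greatest)
    fix m
    show "dist_int (- x) \<le> \<bar>x - of_int m\<bar>"
      using dist_int_le[of "- x" "- m"] by (simp add: abs_minus_commute)
  qed
  from this[of x] this[of "- x"] show ?thesis by simp
qed

lemma dist_int_le_half: "0 \<le> x \<Longrightarrow> x \<le> 1/2 \<Longrightarrow> dist_int x = x"
proof (rule antisym)
  assume "0 \<le> x" "x \<le> 1/2"
  then show "dist_int x \<le> x" using dist_int_le[of x 0] by simp
  show "x \<le> dist_int x"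
  proof (rule dist_int_greatest)
    fix m :: int
    show "x \<le> \<bar>x - of_int m\<bar>"
    proof (cases "m \<le> 0")
      case True
      then have "real_of_int m \<le> 0" by simp
      then show ?thesis using \<open>0 \<le> x\<close> by linarith
    next
      case False
      then have "1 \<le> real_of_int m" by linarith
      then show ?thesis using \<open>x \<le> 1/2\<close> by linarith
    qed
  qed
qed

lemma dist_int_bound: "dist_int x \<le> 1/2"
proof -
  have "\<bar>x - of_int (round x)\<bar> \<le> 1/2"
    using of_int_round_abs_le[of x] by (simp add: abs_minus_commute)
  then show ?thesis using dist_int_le[of x "round x"] by linarith
qed

lemma dist_int_nat_shift: "dist_int (x + real n) = dist_int x"
  by (induction n) (simp_all add: dist_int_add1 add.assoc[symmetric] add.commute[of 1])

lemma takagi_double: "takagi x = dist_int x + takagi (2 * x) / 2"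
proof -
  have "takagi x = dist_int x + (\<Sum>i. dist_int (2 ^ Suc i * x) / 2 ^ Suc i)"
    unfolding takagi_def using suminf_split_head[OF summable_takagi[of x]] by simp
  also have "(\<Sum>i. dist_int (2 ^ Suc i * x) / 2 ^ Suc i) = takagi (2 * x) / 2"
    unfolding takagi_def suminf_divide[OF summable_takagi, symmetric]
    by (simp add: mult_ac)
  finally show ?thesis .
qed

lemma takagi_add1: "takagi (x + 1) = takagi x"
proof -
  have "dist_int (2 ^ i * (x + 1)) = dist_int (2 ^ i * x)" for i
    using dist_int_nat_shift[of "2 ^ i * x" "2 ^ i"] by (simp add: distrib_left)
  then show ?thesis by (simp add: takagi_def)
qed

lemma takagi_reflect: "takagi (1 - x) = takagi x"
  using takagi_add1[of "- x"] by (simp add: takagi_def dist_int_minus)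

lemma takagi_nonneg: "0 \<le> takagi x"
  unfolding takagi_def by (rule suminf_nonneg[OF summable_takagi]) (simp add: dist_int_nonneg)

lemma takagi_0: "takagi 0 = 0"
  using takagi_double[of 0] by (simp add: dist_int_le_half)

lemma takagi_1: "takagi 1 = 0"
  using takagi_reflect[of 0] by (simp add: takagi_0)

lemma takagi_left: "0 \<le> x \<Longrightarrow> x \<le> 1/2 \<Longrightarrow> takagi x = x + takagi (2 * x) / 2"
  using takagi_double[of x] dist_int_le_half by simp

lemma takagi_right: "1/2 \<le> x \<Longrightarrow> x \<le> 1 \<Longrightarrow> takagi x = 1 - x + takagi (2 * x - 1) / 2"
  using takagi_left[of "1 - x"] takagi_reflect[of x] takagi_reflect[of "2 * x - 1"]
  by (simp add: algebra_simps)

lemma continuous_on_takagi: "continuous_on UNIV takagi"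
proof -
  have "uniform_limit UNIV (\<lambda>n x. \<Sum>i<n. dist_int (2 ^ i * x) / 2 ^ i)
          (\<lambda>x. \<Sum>i. dist_int (2 ^ i * x) / 2 ^ i) sequentially"
  proof (rule Weierstrass_m_test)
    show "summable (\<lambda>i. (1 / 2 :: real) ^ i)" by (rule summable_geometric) simp
    show "norm (dist_int (2 ^ n * x) / 2 ^ n) \<le> (1/2) ^ n" for n x
      using dist_int_bound[of "2 ^ n * x"] dist_int_nonneg[of "2 ^ n * x"]
      by (simp add: power_one_over divide_right_mono inverse_eq_divide)
  qed
  then have "continuous_on UNIV (\<lambda>x. \<Sum>i. dist_int (2 ^ i * x) / 2 ^ i)"
    by (rule uniform_limit_theorem[rotated])
      (auto simp: dist_int_def intro!: always_eventually continuous_intros)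
  then show ?thesis by (simp add: takagi_def[abs_def])
qed

text \<open>Two consecutive terms of the series add up to at most 1/2 and leave
  \<open>takagi (4 * x) / 4\<close>, so the best bound solves \<open>M = 1/2 + M / 4\<close>.
  Iterating from the crude bound 2 converges to it.\<close>

lemma takagi_le: "takagi x \<le> 2/3"
proof -
  have step: "dist_int x + dist_int (2 * x) / 2 \<le> 1/2" for x
  proof -
    define u where "u = x - of_int \<lfloor>x\<rfloor>"
    have u: "x = u + of_int \<lfloor>x\<rfloor>" "0 \<le> u" "u \<le> 1" unfolding u_def by linarith+
    have "dist_int x \<le> u" "dist_int x \<le> 1 - u" 
      using dist_int_le[of x "\<lfloor>x\<rfloor>"] dist_int_le[of x "\<lfloor>x\<rfloor> + 1"] u by auto
    moreover have "dist_int (2 * x) \<le> \<bar>2 * u - 1\<bar>"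
      using dist_int_le[of "2 * x" "2 * \<lfloor>x\<rfloor> + 1"] u(1) by (simp add: algebra_simps)
    ultimately show ?thesis by linarith
  qed
  have bd: "takagi x \<le> 2" for x
  proof -
    have "takagi x \<le> (\<Sum>i. (1/2) ^ i)"
      unfolding takagi_def
    proof (intro suminf_le summable_takagi summable_geometric)
      show "dist_int (2 ^ n * x) / 2 ^ n \<le> (1/2) ^ n" for n
        using dist_int_bound[of "2 ^ n * x"]
        by (simp add: power_one_over divide_right_mono inverse_eq_divide)
    qed simp
    then show ?thesis by (simp add: suminf_geometric)
  qed
  have "takagi x \<le> 2/3 + 2 / 4 ^ n" for n x
  proof (induction n arbitrary: x)
    case 0
    show ?case using bd[of x] by simp
  next
    case (Suc n)
    have "takagi x = dist_int x + dist_int (2 * x) / 2 + takagi (4 * x) / 4"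
      using takagi_double[of x] takagi_double[of "2 * x"] by simp
    moreover have "takagi (4 * x) / 4 \<le> (2/3 + 2 / 4 ^ n) / 4"
      by (rule divide_right_mono[OF Suc]) simp
    ultimately show ?case using step[of x] by simp
  qed
  moreover have "(\<lambda>n. 2/3 + 2 / 4 ^ n :: real) \<longlonglongrightarrow> 2/3 + 0"
    by (intro tendsto_intros LIMSEQ_divide_realpow_zero) simp
  ultimately show ?thesis by (intro LIMSEQ_le_const[of _ "2/3"]) auto
qed

section \<open>Tilted Takagi functions\<close>

definition tilt :: "nat \<Rightarrow> real \<Rightarrow> real" where
  "tilt k x = takagi x - real k * x"

definition tilt_level :: "nat \<Rightarrow> real \<Rightarrow> real set" where
  "tilt_level k v = {x \<in> {0..1}. tilt k x = v}"

definition level_card :: "nat \<Rightarrow> real \<Rightarrow> nat \<Rightarrow> bool" where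
  "level_card k v m \<longleftrightarrow> finite (tilt_level k v) \<and> card (tilt_level k v) = m"

lemma tilt_left: "0 \<le> x \<Longrightarrow> x \<le> 1/2 \<Longrightarrow> tilt (Suc k) x = tilt k (2 * x) / 2"
  by (simp add: tilt_def takagi_left algebra_simps)

lemma tilt_right:
  "1/2 \<le> x \<Longrightarrow> x \<le> 1 \<Longrightarrow> tilt (Suc k) x = (tilt (Suc (Suc k)) (2 * x - 1) - real k) / 2"
  by (simp add: tilt_def takagi_right field_simps)

lemma tilt_lower: "0 \<le> x \<Longrightarrow> x \<le> 1 \<Longrightarrow> - real k \<le> tilt k x"
  using takagi_nonneg[of x] mult_left_le[of x "real k"] by (simp add: tilt_def)

lemma tilt_lower_strict: "0 \<le> x \<Longrightarrow> x < 1 \<Longrightarrow> 0 < k \<Longrightarrow> - real k < tilt k x"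
proof -
  assume "0 \<le> x" "x < 1" "0 < k"
  then have "real k * x < real k * 1" by (intro mult_strict_left_mono) auto
  then show ?thesis using takagi_nonneg[of x] by (simp add: tilt_def)
qed

text \<open>The left half halves the maximum. On the right half \<open>x > 1/2\<close> already
  pushes the value down to 1/6 for slope 1 and to 0 for larger slopes.\<close>

lemma tilt_upper: "0 \<le> x \<Longrightarrow> x \<le> 1 \<Longrightarrow> tilt k x \<le> (2/3) / 2 ^ k"
proof (induction k arbitrary: x)
  case 0
  show ?case using takagi_le[of x] by (simp add: tilt_def)
next
  case (Suc k)
  show ?case
  proof (cases "x \<le> 1/2")
    case True
    then show ?thesis using Suc.IH[of "2 * x"] Suc.prems by (simp add: tilt_left)
  next
    case False
    show ?thesis
    proof (cases k)
      case 0
      then show ?thesis using False takagi_le[of x] by (simp add: tilt_def)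
    next
      case (Suc i)
      have "2 * x + real i * x > 2/3" using False mult_nonneg_nonneg[of "real i" x] by linarith
      then have "tilt (Suc k) x \<le> 0"
        using takagi_le[of x] by (simp add: tilt_def Suc algebra_simps)
      also have "0 \<le> (2/3 :: real) / 2 ^ Suc k" by simp
      finally show ?thesis .
    qed
  qed
qed

lemma tilt_level_below: "v < - real k \<Longrightarrow> tilt_level k v = {}"
  using tilt_lower by (auto simp: tilt_level_def dest: leD)

lemma tilt_level_above: "(2/3) / 2 ^ k < v \<Longrightarrow> tilt_level k v = {}"
  using tilt_upper by (auto simp: tilt_level_def dest: leD)

lemma tilt_level_Suc:
  "tilt_level (Suc k) v = (\<lambda>x. x / 2) ` tilt_level k (2 * v) \<union>
     (\<lambda>x. (x + 1) / 2) ` tilt_level (Suc (Suc k)) (2 * v + real k)" (is "?L = ?A \<union> ?B")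
proof (intro equalityI subsetI)
  fix x assume x: "x \<in> ?L"
  show "x \<in> ?A \<union> ?B"
  proof (cases "x \<le> 1/2")
    case True
    then have "2 * x \<in> tilt_level k (2 * v)"
      using x by (auto simp: tilt_level_def tilt_left)
    then show ?thesis by (auto intro!: image_eqI[of _ _ "2 * x"])
  next
    case False
    then have "2 * x - 1 \<in> tilt_level (Suc (Suc k)) (2 * v + real k)"
      using x tilt_right[of x k] by (auto simp: tilt_level_def)
    then show ?thesis by (auto intro!: image_eqI[of _ _ "2 * x - 1"])
  qed
next
  fix x assume "x \<in> ?A \<union> ?B"
  then consider "2 * x \<in> tilt_level k (2 * v)"
    | "2 * x - 1 \<in> tilt_level (Suc (Suc k)) (2 * v + real k)"
    by (auto simp: add_divide_distrib)
  then show "x \<in> ?L"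
  proof cases
    case 1
    then show ?thesis using tilt_left[of x k] by (auto simp: tilt_level_def)
  next
    case 2
    then show ?thesis using tilt_right[of x k] by (auto simp: tilt_level_def)
  qed
qed

section \<open>Counting solutions through the two halves\<close>

lemma level_card_inj_image:
  assumes "tilt_level k v = f ` tilt_level l w" "inj f"
  shows "level_card k v m \<longleftrightarrow> level_card l w m"
  using assms by (simp add: level_card_def card_image finite_image_iff inj_on_subset[OF _ subset_UNIV])

lemma level_card_left:
  assumes "(2/3) / 2 ^ (k + 2) < 2 * v + real k"
  shows "level_card (Suc k) v m \<longleftrightarrow> level_card k (2 * v) m"
proof (rule level_card_inj_image)
  show "tilt_level (Suc k) v = (\<lambda>x. x / 2) ` tilt_level k (2 * v)"
    using assms tilt_level_above[of "Suc (Suc k)"] by (subst tilt_level_Suc) simp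
qed (simp add: inj_def)

lemma level_card_right:
  assumes "2 * v < - real k"
  shows "level_card (Suc k) v m \<longleftrightarrow> level_card (Suc (Suc k)) (2 * v + real k) m"
proof (rule level_card_inj_image)
  show "tilt_level (Suc k) v = (\<lambda>x. (x + 1) / 2) ` tilt_level (Suc (Suc k)) (2 * v + real k)"
    using assms tilt_level_below[of "2 * v" k] by (subst tilt_level_Suc) simp
qed (simp add: inj_def)

text \<open>The halves meet only at \<open>x = 1/2\<close>, where \<open>tilt (Suc k)\<close> equals
  \<open>- k / 2\<close>. The first hypothesis excludes this height, so the counts add.\<close>

lemma level_card_both:
  assumes "2 * v \<noteq> - real k" "level_card k (2 * v) a" "level_card (Suc (Suc k)) (2 * v + real k) b"
  shows "level_card (Suc k) v (a + b)"
proof -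
  let ?f = "\<lambda>x::real. x / 2" and ?g = "\<lambda>x::real. (x + 1) / 2"
  have 1: "1 \<notin> tilt_level k (2 * v)"
    using assms(1) by (auto simp: tilt_level_def tilt_def takagi_1)
  have "x = 1" if "x \<in> tilt_level k (2 * v)" "y \<in> tilt_level (Suc (Suc k)) (2 * v + real k)" 
      "?f x = ?g y" for x y
    using that by (auto simp: tilt_level_def)
  then have "?f ` tilt_level k (2 * v) \<inter> ?g ` tilt_level (Suc (Suc k)) (2 * v + real k) = {}"
    using 1 by blast
  then show ?thesis
    using assms unfolding level_card_def tilt_level_Suc[of k v]
    by (simp add: card_Un_disjoint card_image inj_on_def)
qed

text \<open>From slope 0 the left half would lead to slope -1, so it is treated as the mirror image
  of the right half. The excluded height 1/2 is the value at their common point.\<close>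

lemma level_card_0:
  assumes "y \<noteq> 1/2" "level_card 1 (2 * y - 1) m"
  shows "level_card 0 y (2 * m)"
proof -
  let ?S = "tilt_level 1 (2 * y - 1)"
  let ?f = "\<lambda>x::real. (x + 1) / 2" and ?g = "\<lambda>x::real. (1 - x) / 2"
  have half: "x \<in> tilt_level 0 y \<longleftrightarrow> 2 * x - 1 \<in> ?S" if "1/2 \<le> x" for x
    using that by (auto simp: tilt_level_def tilt_def takagi_right)
  have refl: "1 - x \<in> tilt_level 0 y \<longleftrightarrow> x \<in> tilt_level 0 y" for x
    by (auto simp: tilt_level_def tilt_def takagi_reflect)
  have eq: "tilt_level 0 y = ?f ` ?S \<union> ?g ` ?S"
  proof (intro equalityI subsetI)
    fix x assume x: "x \<in> tilt_level 0 y"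
    show "x \<in> ?f ` ?S \<union> ?g ` ?S"
    proof (cases "1/2 \<le> x")
      case True
      then have "2 * x - 1 \<in> ?S" using x half by blast
      then show ?thesis by (auto intro!: image_eqI[of _ _ "2 * x - 1"])
    next
      case False
      then have "1 - 2 * x \<in> ?S" using x half[of "1 - x"] refl[of x] by simp
      then show ?thesis by (auto intro!: image_eqI[of _ _ "1 - 2 * x"])
    qed
  next
    fix x assume "x \<in> ?f ` ?S \<union> ?g ` ?S"
    then consider u where "u \<in> ?S" "x = ?f u" | u where "u \<in> ?S" "x = 1 - ?f u"
      by (auto simp: field_simps)
    then show "x \<in> tilt_level 0 y"
    proof cases
      case 1
      then have "2 * x - 1 = u" "1/2 \<le> x" by (auto simp: tilt_level_def)
      then show ?thesis using half[of x] 1 by metis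
    next
      case 2
      then have "2 * ?f u - 1 = u" "1/2 \<le> ?f u" by (auto simp: tilt_level_def add_divide_distrib)
      then show ?thesis using half[of "?f u"] refl[of "?f u"] 2 by metis
    qed
  qed
  have "0 \<notin> ?S" using assms(1) by (auto simp: tilt_level_def tilt_def takagi_0)
  moreover have "u = 0" if "u \<in> ?S" "w \<in> ?S" "?f u = ?g w" for u w
    using that by (auto simp: tilt_level_def)
  ultimately have "?f ` ?S \<inter> ?g ` ?S = {}" by blast
  then show ?thesis
    using assms(2) unfolding level_card_def eq
    by (simp add: card_Un_disjoint card_image inj_on_def)
qed

lemma level_card_empty: "level_card k v 0" if "tilt_level k v = {}"
  using that by (simp add: level_card_def)

section \<open>Humps\<close>

text \<open>The values of \<open>tilt k\<close> at points whose slope walk started at \<open>k\<close> reaches 0 within \<open>n\<close> binary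
  digits lie in \<open>humps n k\<close>.\<close>

fun humps :: "nat \<Rightarrow> nat \<Rightarrow> real set" where
  "humps n 0 = {0..2/3}"
| "humps 0 (Suc k) = {}"
| "humps (Suc n) (Suc k) =
     (\<lambda>v. v / 2) ` humps n k \<union> (\<lambda>v. (v - real k) / 2) ` humps n (Suc (Suc k))"

definition hump_union :: "nat \<Rightarrow> real set" where
  "hump_union k = (\<Union>n. humps n k)"

lemma compact_humps: "compact (humps n k)"
proof (induction n k rule: humps.induct)
  case (3 n k)
  then show ?case
    by (auto intro!: compact_Un compact_continuous_image continuous_intros)
qed auto

lemma humps_mono: "humps n k \<subseteq> humps (Suc n) k"
  by (induction n k rule: humps.induct) auto

lemma measure_affine_image:
  "measure lebesgue ((\<lambda>x. a * x + b) ` S) = \<bar>a\<bar> * measure lebesgue S" for a b :: real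
  using measure_lebesgue_affine[of a b S] by simp

text \<open>Both branches halve lengths, so each stage is bounded by the average of two earlier
  bounds, and 2/3 persists.\<close>

lemma measure_humps: "measure lebesgue (humps n k) \<le> 2/3"
proof (induction n k rule: humps.induct)
  case (3 n k)
  have "measure lebesgue (humps (Suc n) (Suc k)) \<le>
      measure lebesgue ((\<lambda>v. v / 2) ` humps n k) +
      measure lebesgue ((\<lambda>v. (v - real k) / 2) ` humps n (Suc (Suc k)))"
    unfolding humps.simps
    by (intro measure_Un_le fmeasurableD lmeasurable_compact compact_continuous_image
        compact_humps continuous_intros) auto
  also have "\<dots> = measure lebesgue (humps n k) / 2 + measure lebesgue (humps n (Suc (Suc k))) / 2"
    using measure_affine_image[of "1/2" 0 "humps n k"]
      measure_affine_image[of "1/2" "- real k / 2" "humps n (Suc (Suc k))"]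
    by (simp add: diff_divide_distrib)
  finally show ?case using 3 by simp
qed auto

lemma
  shows hump_union_measurable: "hump_union k \<in> lmeasurable"
    and measure_hump_union: "measure lebesgue (hump_union k) \<le> 2/3"
proof -
  have inc: "incseq (\<lambda>n. humps n k)" by (rule incseq_SucI) (rule humps_mono)
  have meas: "humps n k \<in> lmeasurable" for n by (intro lmeasurable_compact compact_humps)
  have Un: "(\<Union>i\<le>n. humps i k) = humps n k" for n
    using inc by (auto simp: incseq_def)
  have bound: "measure lebesgue (\<Union>i\<le>n. humps i k) \<le> 2/3" for n
    unfolding Un by (rule measure_humps)
  show "hump_union k \<in> lmeasurable" "measure lebesgue (hump_union k) \<le> 2/3"
    unfolding hump_union_def
    by (rule fmeasurable_countable_Union[OF meas bound] measure_countable_Union_le[OF meas bound])+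
qed

lemma hump_union_0: "hump_union 0 = {0..2/3}"
  by (simp add: hump_union_def)

lemma hump_union_left: "2 * v \<in> hump_union k \<Longrightarrow> v \<in> hump_union (Suc k)"
proof -
  assume "2 * v \<in> hump_union k"
  then obtain n where "2 * v \<in> humps n k" by (auto simp: hump_union_def)
  then have "v \<in> humps (Suc n) (Suc k)" by (auto intro!: image_eqI[of _ _ "2 * v"])
  then show ?thesis by (auto simp: hump_union_def simp del: humps.simps)
qed

lemma hump_union_right: "2 * v + real k \<in> hump_union (Suc (Suc k)) \<Longrightarrow> v \<in> hump_union (Suc k)"
proof -
  assume "2 * v + real k \<in> hump_union (Suc (Suc k))"
  then obtain n where "2 * v + real k \<in> humps n (Suc (Suc k))" by (auto simp: hump_union_def)
  then have "v \<in> humps (Suc n) (Suc k)" by (auto intro!: image_eqI[of _ _ "2 * v + real k"])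
  then show ?thesis by (auto simp: hump_union_def simp del: humps.simps)
qed

lemma tilt_0_in_hump_union: "tilt 0 x \<in> hump_union 0"
  using takagi_nonneg[of x] takagi_le[of x] by (simp add: hump_union_0 tilt_def)

text \<open>Each digit at least doubles a positive value, while all values stay below 1. So a value
  of at least \<open>1 / 2 ^ n\<close> reaches slope 0 within \<open>n\<close> digits.\<close>

lemma tilt_pos_in_hump_union:
  assumes "0 \<le> x" "x \<le> 1" "tilt k x > 0"
  shows "tilt k x \<in> hump_union k"
proof -
  have "tilt k x \<in> hump_union k" if "0 \<le> x" "x \<le> 1" "1 / 2 ^ n \<le> tilt k x" for n k x
    using that
  proof (induction n arbitrary: k x)
    case 0
    have "real k * x \<ge> 0" using 0 by simp
    then have False using 0(3) takagi_le[of x] unfolding tilt_def by auto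
    then show ?case ..
  next
    case (Suc n)
    show ?case
    proof (cases k)
      case 0
      then show ?thesis using tilt_0_in_hump_union by simp
    next
      case k: (Suc i)
      show ?thesis
      proof (cases "x \<le> 1/2")
        case True
        then have "2 * tilt k x = tilt i (2 * x)" using Suc.prems by (simp add: k tilt_left)
        then show ?thesis
          using Suc.IH[of "2 * x" i] Suc.prems True hump_union_left[of "tilt k x" i]
          unfolding k by simp
      next
        case False
        then have "2 * tilt k x + real i = tilt (Suc (Suc i)) (2 * x - 1)"
          using Suc.prems tilt_right[of x i] by (simp add: k)
        moreover have "1 / 2 ^ n \<le> 2 * tilt k x + real i"
          using Suc.prems(3) by simp
        ultimately show ?thesis
          using Suc.IH[of "2 * x - 1" "Suc (Suc i)"] Suc.prems False hump_union_right[of "tilt k x" i]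
          by (simp add: k)
      qed
    qed
  qed
  moreover obtain n where "1 / 2 ^ n < tilt k x"
    using real_arch_pow_inv[OF assms(3), of "1/2"] by (auto simp: power_one_over inverse_eq_divide)
  ultimately show ?thesis using assms by (meson less_imp_le)
qed

text \<open>Two solutions off the humps are not separated by any binary digit: at the first differing
  digit the left one would lie strictly above the split point of the tile and the right one below.\<close>

lemma tilt_inj_off_humps:
  assumes "x \<in> tilt_level k v" "x' \<in> tilt_level k v" "v \<notin> hump_union k"
  shows "x = x'"
proof -
  \<comment> \<open>One-sided, but for all ordered pairs: applied in both orders it forces
    equality.\<close>
  have "x' - x < 1 / 2 ^ n" if "x \<in> tilt_level k v" "x' \<in> tilt_level k v" "v \<notin> hump_union k" for n k v x x'
    using that
  proof (induction n arbitrary: k v x x')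
    case 0
    have "k \<noteq> 0"
    proof
      assume "k = 0"
      then show False using 0 tilt_0_in_hump_union[of x] by (simp add: tilt_level_def)
    qed
    then have "\<not> (x = 0 \<and> x' = 1)"
      using 0 by (auto simp: tilt_level_def tilt_def takagi_0 takagi_1)
    then show ?case using 0 by (auto simp: tilt_level_def)
  next
    case (Suc n)
    obtain i where k: "k = Suc i"
      using Suc.prems tilt_0_in_hump_union[of x] by (cases k) (auto simp: tilt_level_def)
    have no: "2 * v \<notin> hump_union i" "2 * v + real i \<notin> hump_union (Suc (Suc i))"
      using Suc.prems hump_union_left hump_union_right unfolding k by blast+
    have x: "0 \<le> x" "x \<le> 1" "tilt (Suc i) x = v" "0 \<le> x'" "x' \<le> 1" "tilt (Suc i) x' = v"
      using Suc.prems by (auto simp: tilt_level_def k)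
    consider "x' \<le> x" | "x' \<le> 1/2" "x \<le> 1/2" | "1/2 \<le> x" "1/2 \<le> x'" | "x < 1/2" "1/2 < x'"
      by linarith
    then show ?case
    proof cases
      case 1
      then show ?thesis by (simp add: le_less_trans[of _ 0])
    next
      case 2
      then have "2 * x' - 2 * x < 1 / 2 ^ n"
        using no x by (intro Suc.IH[of _ i "2 * v"]) (auto simp: tilt_level_def tilt_left)
      then show ?thesis by (simp add: field_simps)
    next
      case 3
      then have "(2 * x' - 1) - (2 * x - 1) < 1 / 2 ^ n"
        using no x tilt_right[of x i] tilt_right[of x' i]
        by (intro Suc.IH[of _ "Suc (Suc i)" "2 * v + real i"]) (auto simp: tilt_level_def)
      then show ?thesis by (simp add: field_simps)
    next
      case 4
      have L: "tilt i (2 * x) = 2 * v" using 4 x by (simp add: tilt_left)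
      then have "i \<noteq> 0" using no tilt_0_in_hump_union[of "2 * x"] by metis
      \<comment> \<open>Hence the right value \<open>2 * v + i\<close> is positive and must lie in a
        hump.\<close>
      then have "- real i < 2 * v" using tilt_lower_strict[of "2 * x" i] 4 x L by simp
      moreover have "tilt (Suc (Suc i)) (2 * x' - 1) = 2 * v + real i"
        using 4 x tilt_right[of x' i] by simp
      ultimately have False
        using no tilt_pos_in_hump_union[of "2 * x' - 1" "Suc (Suc i)"] 4 x by simp
      then show ?thesis ..
    qed
  qed
  note close = this
  have "\<not> y < z" if "y \<in> tilt_level k v" "z \<in> tilt_level k v" for y z
  proof
    assume "y < z"
    then obtain n where "(1/2) ^ n < z - y"
      using real_arch_pow_inv[of "z - y" "1/2"] by auto
    then show False using close[OF that assms(3), of n] by (simp add: power_one_over)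
  qed
  then show ?thesis using assms by (meson linorder_neqE)
qed

text \<open>Existence holds because \<open>tilt k\<close> runs continuously from 0 to
  \<open>- k\<close>.\<close>

lemma level_card_off_humps:
  assumes "- real k \<le> v" "v \<le> 0" "v \<notin> hump_union k"
  shows "level_card k v 1"
proof -
  have "continuous_on {0..1} (tilt k)"
    unfolding tilt_def[abs_def]
    by (intro continuous_intros continuous_on_subset[OF continuous_on_takagi]) auto
  then obtain x where "0 \<le> x" "x \<le> 1" "tilt k x = v"
    using IVT2'[of "tilt k" 1 v 0] assms by (auto simp: tilt_def takagi_0 takagi_1)
  then have "x \<in> tilt_level k v" by (simp add: tilt_level_def)
  then have "tilt_level k v = {x}" using tilt_inj_off_humps assms(3) by blast
  then show ?thesis by (simp add: level_card_def)
qed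

section \<open>Heights with prescribed cardinality\<close>

lemma negligible_affine_image:
  fixes a b :: real
  assumes "negligible S"
  shows "negligible ((\<lambda>x. a * x + b) ` S)"
  by (rule negligible_differentiable_image_negligible[OF _ assms])
    (auto intro!: differentiable_on_add differentiable_on_mult)

text \<open>The inverse map would carry a negligible \<open>T\<close> to a negligible cover of
  \<open>S\<close>. This works for sets whose measurability is unknown.\<close>

lemma not_negligible_affine_subset:
  fixes a b :: real
  assumes "\<not> negligible S" "a \<noteq> 0" "\<And>x. x \<in> S \<Longrightarrow> a * x + b \<in> T"
  shows "\<not> negligible T"
proof
  assume "negligible T"
  then have "negligible ((\<lambda>x. (1/a) * x + (- b / a)) ` T)" by (rule negligible_affine_image)
  moreover have "S \<subseteq> (\<lambda>x. (1/a) * x + (- b / a)) ` T"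
  proof
    fix x assume "x \<in> S"
    then show "x \<in> (\<lambda>x. (1/a) * x + (- b / a)) ` T"
      using assms by (intro image_eqI[of _ _ "a * x + b"]) (auto simp: add_divide_distrib)
  qed
  ultimately show False using assms(1) negligible_subset by blast
qed

section \<open>From tiles to heights of the Takagi function\<close>

definition tile_heights :: "nat \<Rightarrow> nat \<Rightarrow> real set" where
  "tile_heights k m = {v \<in> {1/24 - real k<..<0}. level_card k v m}"

text \<open>The cutoff 1/6 is \<open>(2/3) / 2 ^ 2\<close>, the upper bound for
  \<open>tilt 2\<close>; above it \<open>tilt 2\<close> has no solutions.\<close>

definition top_heights :: "nat \<Rightarrow> real set" where
  "top_heights m = {y \<in> {1/6<..2/3}. level_card 0 y (2 * m)}"

text \<open>Prepends the binary digits 110, leading through the slopes \<open>i + 2\<close>, \<open>i + 3\<close>, \<open>i + 2\<close>. The margin 1/24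
  bounds \<open>tilt (i + 4)\<close>, that is, the overlap of the right neighbour with the inner tile.\<close>

lemma level_card_block:
  assumes "v \<in> tile_heights (Suc (Suc i)) m"
  defines "w \<equiv> v / 8 - (3 * real i + 1) / 4"
  shows "level_card (Suc i) w m" "1/24 - real (Suc i) < w" "w < 0"
proof -
  have v: "1/24 - (real i + 2) < v" "v < 0" "level_card (Suc (Suc i)) v m"
    using assms by (auto simp: tile_heights_def)
  \<comment> \<open>Read forwards from \<open>w\<close>, the digits 1, 1, 0 give the heights
    \<open>w1\<close>, \<open>v / 2\<close>, \<open>v\<close>; the counts are transferred
    backwards.\<close>
  define w1 where "w1 = v / 4 - (real i + 1) / 2"
  have "(2/3) / 2 ^ (Suc (Suc i) + 2) \<le> (2/3 :: real) / 2 ^ 4"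
    by (intro divide_left_mono power_increasing) auto
  also have "\<dots> < 2 * (v / 2) + real (Suc (Suc i))"
    using v(1) by simp
  finally have "level_card (Suc (Suc (Suc i))) (v / 2) m"
    using v level_card_left[of "Suc (Suc i)" "v / 2" m] by simp
  moreover have w1: "2 * w1 + real (Suc i) = v / 2" by (simp add: w1_def)
  then have "2 * w1 < - real (Suc i)" using v(2) by linarith
  ultimately have "level_card (Suc (Suc i)) w1 m"
    using level_card_right[of w1 "Suc i" m] unfolding w1 by blast
  moreover have "2 * w + real i = w1" by (simp add: w_def w1_def add_divide_distrib)
  moreover have "w1 < 0" using v(2) by (simp add: w1_def)
  ultimately show "level_card (Suc i) w m"
    using level_card_right[of w i m] by simp
  have "w = v / 8 - 3/4 * real i - 1/4" by (simp add: w_def add_divide_distrib)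
  then show "1/24 - real (Suc i) < w" "w < 0" using v(1,2) by simp_all
qed

text \<open>Each block of digits lowers the starting slope by one and keeps the count
  \<open>m\<close>.\<close>

lemma tile_heights_descend:
  "\<not> negligible (tile_heights (Suc (Suc j)) m) \<Longrightarrow> \<not> negligible (tile_heights (Suc (Suc 0)) m)"
proof (induction j)
  case (Suc j)
  have "\<not> negligible (tile_heights (Suc (Suc j)) m)"
  proof (rule not_negligible_affine_subset)
    show "\<not> negligible (tile_heights (Suc (Suc (Suc j))) m)" by fact
    fix v assume v: "v \<in> tile_heights (Suc (Suc (Suc j))) m"
    have "1/8 * v + - ((3 * real (Suc j) + 1) / 4) = v / 8 - (3 * real (Suc j) + 1) / 4" by simp
    then show "1/8 * v + - ((3 * real (Suc j) + 1) / 4) \<in> tile_heights (Suc (Suc j)) m"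
      using level_card_block[OF v] unfolding tile_heights_def by (simp only: mem_Collect_eq) simp
  qed simp
  then show ?case by (rule Suc.IH)
qed simp

lemma top_heights_of_tile:
  assumes "\<not> negligible (tile_heights (Suc (Suc j)) m)"
  shows "\<not> negligible (top_heights m)"
proof (rule not_negligible_affine_subset)
  show "\<not> negligible (tile_heights (Suc (Suc 0)) m)" using tile_heights_descend[OF assms] .
  fix v assume v: "v \<in> tile_heights (Suc (Suc 0)) m"
  \<comment> \<open>Solves \<open>2 * ?y - 1 = v / 8 - 1/4\<close>, the height at slope 1 produced
    by the block with \<open>i = 0\<close>.\<close>
  let ?y = "1/16 * v + 3/8"
  have "2 * ?y - 1 = v / 8 - (3 * real 0 + 1) / 4" by simp
  moreover have "level_card (Suc 0) (v / 8 - (3 * real 0 + 1) / 4) m"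
    using level_card_block(1)[of v 0 m] v by simp
  ultimately have "level_card 1 (2 * ?y - 1) m" by simp
  moreover have "1/6 < ?y" "?y < 1/2" using v by (auto simp: tile_heights_def)
  ultimately show "?y \<in> top_heights m"
    using level_card_0[of ?y m] by (simp add: top_heights_def)
qed simp

lemma top_heights_1: "\<not> negligible (top_heights 1)"
proof (rule top_heights_of_tile[of 0])
  show "\<not> negligible (tile_heights (Suc (Suc 0)) 1)"
  proof
    assume neg: "negligible (tile_heights (Suc (Suc 0)) 1)"
    \<comment> \<open>The length 23/24 of this interval exceeds the 2/3 that humps can
      cover.\<close>
    have "{-1..-1/24} \<subseteq> hump_union (Suc (Suc 0)) \<union> tile_heights (Suc (Suc 0)) 1"
      using level_card_off_humps[of "Suc (Suc 0)"] by (auto simp: tile_heights_def)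
    moreover have "hump_union (Suc (Suc 0)) \<union> tile_heights (Suc (Suc 0)) 1 \<in> lmeasurable"
      using neg hump_union_measurable negligible_imp_measurable by blast
    ultimately have "measure lebesgue {-1..-1/24::real} \<le> measure lebesgue (hump_union (Suc (Suc 0)) \<union> tile_heights (Suc (Suc 0)) 1)"
      by (intro measure_mono_fmeasurable) auto
    also have "\<dots> \<le> measure lebesgue (hump_union (Suc (Suc 0))) + measure lebesgue (tile_heights (Suc (Suc 0)) 1)"
      using neg hump_union_measurable negligible_imp_measurable
      by (intro measure_Un_le fmeasurableD) auto
    also have "\<dots> \<le> 2/3" using neg measure_hump_union[of "Suc (Suc 0)"] by (simp add: negligible_imp_measure0)
    finally show False by simp
  qed
qed

section \<open>Passing from \<open>r\<close> to \<open>2 * r\<close> and to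
  \<open>2 * r + 1\<close>\<close>

lemma top_heights_double:
  assumes "\<not> negligible (top_heights r)"
  shows "\<not> negligible (top_heights (2 * r))"
proof (rule not_negligible_affine_subset[OF assms])
  fix z assume z: "z \<in> top_heights r"
  let ?y = "1/4 * z + 1/2"
  \<comment> \<open>So at slope 1 only the left half can reach \<open>z / 2\<close>, and the count
    of \<open>z\<close> is kept; the reflection at slope 0 then doubles it.\<close>
  have "tilt_level 2 z = {}" using z by (intro tilt_level_above) (simp add: top_heights_def)
  then have "level_card (Suc 0) (z / 2) (2 * r + 0)"
    using z by (intro level_card_both) (auto simp: top_heights_def level_card_empty numeral_2_eq_2)
  then have "level_card 0 ?y (2 * (2 * r))"
    using z by (intro level_card_0) (auto simp: top_heights_def)
  then show "?y \<in> top_heights (2 * r)" using z by (auto simp: top_heights_def)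
qed simp

lemma hump_union_affine_measurable:
  fixes a b :: real
  shows "(\<lambda>v. a * v + b) ` hump_union k \<in> lmeasurable"
proof (rule fmeasurableI)
  have "(\<lambda>v. a * v + b) ` humps n k \<in> sets lebesgue" for n
    by (intro fmeasurableD lmeasurable_compact compact_continuous_image compact_humps continuous_intros)
  then show "(\<lambda>v. a * v + b) ` hump_union k \<in> sets lebesgue"
    unfolding hump_union_def image_UN by blast
  show "emeasure lebesgue ((\<lambda>v. a * v + b) ` hump_union k) < \<infinity>"
    using emeasure_lebesgue_affine[of a b "hump_union k"] fmeasurableD2[OF hump_union_measurable, of k]
    by (simp add: ennreal_mult_less_top less_top)
qed

text \<open>The walk goes down to slope 0 by \<open>k\<close> digits 0. At each stage
  \<open>z > 1/6\<close> puts the height above the range of the right branch.\<close>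

lemma level_card_single_hump:
  assumes "1/6 < z" "level_card 0 z m"
  shows "level_card k (z / 2 ^ k) m"
proof (induction k)
  case 0
  then show ?case using assms by simp
next
  case (Suc k)
  have "tilt_level (Suc (Suc k)) (z / 2 ^ k + real k) = {}"
  proof (rule tilt_level_above)
    have "(2/3) / 2 ^ Suc (Suc k) = (1/6) / (2 ^ k :: real)" by simp
    also have "\<dots> < z / 2 ^ k" using assms(1) by (intro divide_strict_right_mono) auto
    finally show "(2/3) / 2 ^ Suc (Suc k) < z / 2 ^ k + real k" by simp
  qed
  moreover have "z / 2 ^ k > 0" using assms(1) by simp
  ultimately have "level_card (Suc k) (z / 2 ^ Suc k) (m + 0)"
    using Suc by (intro level_card_both) (auto simp: level_card_empty)
  then show ?case by simp
qed

text \<open>Near its bottom \<open>- k\<close> the tile of \<open>k\<close> is entered only through binary digits 1.\<close>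

lemma level_card_near_bottom:
  assumes "0 < k" "2 ^ l * z < real (k + l)" "level_card (k + l) (2 ^ l * z - real (k + l)) m"
  shows "level_card k (z - real k) m"
  using assms(2,3)
proof (induction l)
  case (Suc l)
  obtain i where i: "k + l = Suc i" using assms(1) by (cases "k + l") auto
  then have i': "real k + real l = real i + 1" by linarith
  have z: "2 * (2 ^ l * z) < real i + 2" using Suc.prems(1) i' by simp
  have "level_card (Suc i) (2 ^ l * z - real (Suc i)) m \<longleftrightarrow>
      level_card (Suc (Suc i)) (2 * (2 ^ l * z - real (Suc i)) + real i) m"
    using z by (intro level_card_right) simp
  moreover have "2 * (2 ^ l * z - real (Suc i)) + real i = 2 ^ Suc l * z - real (k + Suc l)"
    using i' by simp
  ultimately have "level_card (k + l) (2 ^ l * z - real (k + l)) m"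
    using Suc.prems(2) i by (metis add_Suc_right)
  moreover have "2 ^ l * z < real (k + l)" using z i' by simp
  ultimately show ?case by (rule Suc.IH[rotated])
qed simp

text \<open>At height \<open>(c - i) / 2\<close> with small \<open>c > 0\<close>, the left half sees
  \<open>c - i\<close>, near the bottom of the tile of \<open>i\<close>, and gives one solution off
  the humps. The right half sees \<open>c\<close>, in the top hump of slope \<open>i + 2\<close>,
  and gives \<open>2 * r\<close>.\<close>

lemma top_heights_odd:
  assumes "\<not> negligible (top_heights r)"
  shows "\<not> negligible (top_heights (1 + 2 * r))"
proof -
  \<comment> \<open>\<open>e\<close> is a positive lower bound for the outer measure of
    \<open>top_heights r\<close>.\<close>
  obtain e where e: "e > 0"
    and big: "\<And>T. top_heights r \<subseteq> T \<Longrightarrow> T \<in> lmeasurable \<Longrightarrow> e \<le> measure lebesgue T"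
    using assms unfolding negligible_outer by (meson not_less)
  obtain l where l: "(1/2) ^ l < e" using real_arch_pow_inv[OF e, of "1/2"] by auto
  \<comment> \<open>The hump sits at the split point \<open>- i / 2\<close> of the tile of \<open>i + 1\<close>, at scale \<open>2 ^ - (i + 3)\<close>. Its heights
    belong to the subtile of slope \<open>k\<close> at the bottom of the left half, and \<open>Z\<close> collects the humps
    of that subtile in the coordinate \<open>z\<close> of the given hump.\<close>
  define i :: nat where "i = 2 ^ l"
  define k where "k = i + (i + 2 + l)"
  define Z where "Z = (\<lambda>v. (1 / 2 ^ l) * v + real k / 2 ^ l) ` hump_union k"
  have i: "1 \<le> i" by (simp add: i_def)
  have Z: "Z \<in> lmeasurable"
    unfolding Z_def by (rule hump_union_affine_measurable)
  have "measure lebesgue Z = \<bar>1 / 2 ^ l\<bar> * measure lebesgue (hump_union k)"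
    unfolding Z_def by (rule measure_affine_image)
  also have "\<dots> = measure lebesgue (hump_union k) / 2 ^ l" by simp
  also have "\<dots> \<le> 1 / 2 ^ l"
    using measure_hump_union[of k] by (intro divide_right_mono) auto
  finally have Z_small: "measure lebesgue Z < e" using l by (simp add: power_one_over)
  have "\<not> negligible (top_heights r - Z)"
  proof
    assume neg: "negligible (top_heights r - Z)"
    have "e \<le> measure lebesgue (Z \<union> (top_heights r - Z))"
      using fmeasurable.Un[OF Z negligible_imp_measurable[OF neg]] by (intro big) blast
    also have "\<dots> \<le> measure lebesgue Z + measure lebesgue (top_heights r - Z)"
      using neg Z negligible_imp_measurable by (intro measure_Un_le fmeasurableD) auto
    also have "\<dots> = measure lebesgue Z" using neg by (simp add: negligible_imp_measure0)
    finally show False using Z_small by simp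
  qed
  then have "\<not> negligible (tile_heights (Suc i) (1 + 2 * r))"
  proof (rule not_negligible_affine_subset)
    fix z assume z: "z \<in> top_heights r - Z"
    define c where "c = z / 2 ^ (i + 2)"
    have zb: "1/6 < z" "z \<le> 2/3" "level_card 0 z (2 * r)" using z by (auto simp: top_heights_def)
    \<comment> \<open>Of the \<open>i + 2 + l\<close> digits 1 from slope \<open>i\<close> to
      \<open>k\<close>, the first \<open>i + 2\<close> magnify \<open>c\<close> to \<open>z\<close>;
      the other \<open>l\<close> make the humps of slope \<open>k\<close> short relative to
      \<open>z\<close>.\<close>
    have scale: "2 ^ (i + 2 + l) * c = 2 ^ l * z" by (simp add: c_def power_add)
    \<comment> \<open>The choice \<open>i = 2 ^ l\<close> serves this bound, which keeps the height
      inside the tile of \<open>k\<close>.\<close>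
    have "2 ^ l * z < real k"
    proof -
      have "2 ^ l * z \<le> 2 ^ l * 1" using zb by (intro mult_left_mono) auto
      also have "\<dots> = real i" by (simp add: i_def)
      also have "\<dots> < real k" by (simp add: k_def)
      finally show ?thesis .
    qed
    moreover have "2 ^ l * z - real k \<notin> hump_union k"
    proof
      assume "2 ^ l * z - real k \<in> hump_union k"
      then have "z \<in> Z" unfolding Z_def
        by (intro image_eqI[of _ _ "2 ^ l * z - real k"]) (auto simp: diff_divide_distrib right_diff_distrib)
      then show False using z by simp
    qed
    ultimately have "level_card k (2 ^ l * z - real k) 1"
      using zb by (intro level_card_off_humps) auto
    then have "level_card i (c - real i) 1"
      using i scale \<open>2 ^ l * z < real k\<close> level_card_near_bottom[of i "i + 2 + l" c 1]
      by (simp add: k_def)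
    moreover have "level_card (i + 2) c (2 * r)"
      unfolding c_def using zb by (intro level_card_single_hump) auto
    moreover have c: "0 < c" "c < 1"
    proof -
      show "0 < c" using zb by (simp add: c_def)
      have "z < 1 * 2 ^ (i + 2)" using zb one_le_power[of "2::real" "i + 2"] by linarith
      then show "c < 1" unfolding c_def by (subst divide_less_eq) auto
    qed
    ultimately have "level_card (Suc i) ((c - real i) / 2) (1 + 2 * r)"
      by (intro level_card_both) (auto simp: diff_divide_distrib)
    then have "(c - real i) / 2 \<in> tile_heights (Suc i) (1 + 2 * r)"
      using c i by (auto simp: tile_heights_def)
    moreover have "(c - real i) / 2 = (1 / (2 * 2 ^ (i + 2))) * z + - (real i / 2)"
      by (simp add: c_def diff_divide_distrib)
    ultimately show "(1 / (2 * 2 ^ (i + 2))) * z + - (real i / 2) \<in> tile_heights (Suc i) (1 + 2 * r)"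
      by simp
  qed simp
  moreover obtain j where "Suc i = Suc (Suc j)" using i by (metis Suc_le_D One_nat_def)
  ultimately show ?thesis using top_heights_of_tile by metis
qed

lemma top_heights_not_negligible: "n \<ge> 1 \<Longrightarrow> \<not> negligible (top_heights n)"
proof (induction n rule: less_induct)
  case (less n)
  show ?case
  proof (cases "n = 1")
    case True
    then show ?thesis using top_heights_1 by simp
  next
    case False
    have IH: "\<not> negligible (top_heights (n div 2))"
      using less False by (intro less.IH) auto
    show ?thesis
    proof (cases "even n")
      case True
      then show ?thesis using top_heights_double[OF IH] by simp
    next
      case False
      then have "n = 1 + 2 * (n div 2)" by presburger
      then show ?thesis using top_heights_odd[OF IH] by simp
    qed
  qed
qed

section \<open>Measurability\<close>

text \<open>A finite subset of size \<open>m\<close> expresses at least \<open>m\<close> preimages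
  from \<open>a\<close> on; the parameter \<open>a\<close> allows splitting off the smallest
  one.\<close>

definition many_preimages :: "nat \<Rightarrow> real \<Rightarrow> real set" where
  "many_preimages m a = {y. \<exists>F \<subseteq> takagi_level y \<inter> {a..}. finite F \<and> card F = m}"

text \<open>Rationals \<open>p < q\<close> between the smallest preimage and the next make the union
  countable.\<close>

lemma many_preimages_Suc:
  "many_preimages (Suc m) a =
     (\<Union>p\<in>\<rat>. \<Union>q\<in>\<rat> \<inter> {p<..}. takagi ` ({a..p} \<inter> {0..1}) \<inter> many_preimages m q)"
  (is "?L = ?R")
proof (intro equalityI subsetI)
  fix y assume "y \<in> ?L"
  then obtain F where F: "F \<subseteq> takagi_level y \<inter> {a..}" "finite F" "card F = Suc m"
    by (auto simp: many_preimages_def)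
  define x where "x = Min F"
  have x: "x \<in> F" using F unfolding x_def by (intro Min_in) auto
  \<comment> \<open>The default \<open>x + 1\<close> keeps the set nonempty when
    \<open>F = {x}\<close>.\<close>
  define b where "b = Min (insert (x + 1) (F - {x}))"
  have "x < u" if "u \<in> F - {x}" for u
    using that F(2) Min_le[of F u] by (auto simp: x_def less_le)
  then have "x < b" using F(2) by (auto simp: b_def)
  then obtain q where q: "q \<in> \<rat>" "x < q" "q < b" using Rats_dense_in_real by blast
  then obtain p where p: "p \<in> \<rat>" "x < p" "p < q" using Rats_dense_in_real by blast
  have "F - {x} \<subseteq> takagi_level y \<inter> {q..}"
  proof
    fix u assume u: "u \<in> F - {x}"
    then have "b \<le> u" using F(2) unfolding b_def by (intro Min_le) auto
    then show "u \<in> takagi_level y \<inter> {q..}" using u F(1) q(3) by auto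
  qed
  then have "y \<in> many_preimages m q"
    using F x unfolding many_preimages_def by (intro CollectI exI[of _ "F - {x}"]) auto
  moreover have "y \<in> takagi ` ({a..p} \<inter> {0..1})"
    using F(1) x p by (auto simp: takagi_level_def intro!: image_eqI[of _ _ x])
  ultimately show "y \<in> ?R" using p q by blast
next
  fix y assume "y \<in> ?R"
  then obtain p q x F where "p < q" "x \<in> {a..p} \<inter> {0..1}" "y = takagi x"
    and F: "F \<subseteq> takagi_level y \<inter> {q..}" "finite F" "card F = m"
    by (auto simp: many_preimages_def)
  moreover from this have "x \<notin> F" by auto
  ultimately show "y \<in> ?L"
    unfolding many_preimages_def
    by (intro CollectI exI[of _ "insert x F"]) (auto simp: takagi_level_def)
qed

lemma many_preimages_borel: "many_preimages m a \<in> sets borel"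
proof (induction m arbitrary: a)
  case 0
  have "many_preimages 0 a = UNIV" by (auto simp: many_preimages_def)
  then show ?case by simp
next
  case (Suc m)
  have "takagi ` ({a..p} \<inter> {0..1}) \<in> sets borel" for p
    by (intro borel_closed compact_imp_closed compact_continuous_image
        continuous_on_subset[OF continuous_on_takagi] compact_Int) auto
  then show ?case
    unfolding many_preimages_Suc
    by (intro sets.countable_UN'' sets.Int[of "takagi ` _"] Suc.IH countable_rat
        countable_subset[OF Int_lower1 countable_rat])
qed

text \<open>Exactly \<open>m\<close> means at least \<open>m\<close> but not at least
  \<open>m + 1\<close>. Measurability turns non-negligibility into positive \<open>emeasure\<close>,
  which is 0 by convention on non-measurable sets.\<close>

lemma takagi_heights_borel: "takagi_heights m \<in> sets borel"
proof -
  have "takagi_heights m = {0..2/3} \<inter> (many_preimages m 0 - many_preimages (Suc m) 0)"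
  proof (intro set_eqI)
    fix y
    have many: "y \<in> many_preimages m 0 \<longleftrightarrow> (\<exists>F \<subseteq> takagi_level y. finite F \<and> card F = m)" for m
    proof -
      have "takagi_level y \<inter> {0..} = takagi_level y" by (auto simp: takagi_level_def)
      then show ?thesis unfolding many_preimages_def by (simp only: mem_Collect_eq)
    qed
    have "finite (takagi_level y) \<and> card (takagi_level y) = m \<longleftrightarrow>
        y \<in> many_preimages m 0 \<and> y \<notin> many_preimages (Suc m) 0" (is "?P \<longleftrightarrow> ?Q")
    proof
      assume P: ?P
      have "card F \<noteq> Suc m" if "F \<subseteq> takagi_level y" for F
        using P card_mono[of "takagi_level y" F] that by auto
      then show ?Q using P unfolding many by blast
    next
      assume Q: ?Q
      then obtain F where F: "F \<subseteq> takagi_level y" "finite F" "card F = m"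
        unfolding many by blast
      have "takagi_level y \<subseteq> F"
      proof (rule ccontr)
        assume "\<not> takagi_level y \<subseteq> F"
        then obtain x where "x \<in> takagi_level y" "x \<notin> F" by blast
        then have "insert x F \<subseteq> takagi_level y" "finite (insert x F)" "card (insert x F) = Suc m"
          using F by auto
        then show False using Q unfolding many by blast
      qed
      then show ?P using F by auto
    qed
    then show "y \<in> takagi_heights m \<longleftrightarrow> y \<in> {0..2/3} \<inter> (many_preimages m 0 - many_preimages (Suc m) 0)"
      by (auto simp: takagi_heights_def)
  qed
  then show ?thesis using many_preimages_borel by simp
qed

theorem theorem1:
  fixes n :: nat
  assumes "n \<ge> 1"
  shows "emeasure lebesgue (takagi_heights (2 * n)) > 0"
proof -
  have "top_heights n \<subseteq> takagi_heights (2 * n)"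
    by (auto simp: top_heights_def takagi_heights_def level_card_def tilt_level_def
        takagi_level_def tilt_def)
  then have "\<not> negligible (takagi_heights (2 * n))"
    using top_heights_not_negligible[OF assms] negligible_subset by blast
  then have "takagi_heights (2 * n) \<notin> null_sets lebesgue"
    by (simp add: negligible_iff_null_sets)
  moreover have "takagi_heights (2 * n) \<in> sets lebesgue"
    using takagi_heights_borel by simp
  ultimately show ?thesis by (auto simp: null_sets_def zero_less_iff_neq_zero)
qed

end
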